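(* Let $k\ge1$ be an integer, $H>\frac12$, $\lambda>0$, and $d=\frac12-\frac{1-H}{k}$. Then for every $t\ge0$ the function $$h_t(y_1,\ldots,y_k)=\int_0^t\prod_{i=1}^k (s-y_i)_+^{d-1}e^{-\lambda(s-y_i)_+}\,ds$$ is well defined in $L^2(\mathbb R^k)$ (that is, the integral is finite for almost every $(y_1,\ldots,y_k)\in\mathbb R^k$ and $h_t\in L^2(\mathbb R^k)$).
   Context: Convention: $(x)_+=x\,I(x>0)$, and $(x)_+^{d-1}$ means $x^{d-1}$ if $x>0$ and $0$ if $x\le 0$. Note that $H>\frac12$ is equivalent to $d>\frac12-\frac1{2k}$. *)

theory Defs
  imports "HOL-Analysis.Analysis"
begin

definition pos_part :: "real \<Rightarrow> real" where
  "pos_part x = x * of_bool (x > 0)"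

text \<open>The value at \<^term>\<open>x \<le> 0\<close> is 0 for every exponent, including zero and negative ones.\<close>

definition pos_powr :: "real \<Rightarrow> real \<Rightarrow> real" where
  "pos_powr x p = (if x > 0 then x powr p else 0)"

definition hermite_integrand ::
    "real \<Rightarrow> real \<Rightarrow> real ^ 'k \<Rightarrow> real \<Rightarrow> real" where
  "hermite_integrand d lam y s =
     (\<Prod>i\<in>UNIV. pos_powr (s - y $ i) (d - 1) * exp (- lam * pos_part (s - y $ i)))"

text \<open>The Lebesgue integral is 0 by convention at points \<^term>\<open>y\<close> where the
  integrand is not integrable, so integrability has to be claimed separately.\<close>

definition hermite_kernel ::
    "real \<Rightarrow> real \<Rightarrow> real \<Rightarrow> real ^ 'k \<Rightarrow> real" where
  "hermite_kernel d lam t y = (LINT s:{0..t}|lborel. hermite_integrand d lam y s)"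

text \<open>Functions rather than equivalence classes modulo null sets.\<close>

definition L2 :: "'a measure \<Rightarrow> ('a \<Rightarrow> real) set" where
  "L2 M = {f \<in> borel_measurable M. integrable M (\<lambda>x. (f x)\<^sup>2)}"

end

theory Submission
  imports Defs
begin

text \<open>
  Write \<open>g x = x powr (d - 1) * exp (- lam * x)\<close> for \<open>x > 0\<close>. By Tonelli, the integral of the square
  of \<open>h\<^sub>t\<close> is the integral over \<open>(s, r) \<in> [0,t]\<^sup>2\<close> of the \<open>k\<close>-th power of the correlation
  \<open>\<integral> g (s - y) * g (r - y) dy\<close>. Choose \<open>e \<le> d\<close> with \<open>1/2 - 1/(2k) < e < 1/2\<close>. The exponential absorbs
  \<open>x powr (d - e)\<close>, so \<open>g\<close> is dominated by a multiple of \<open>x powr (e - 1)\<close>, and the correlation by a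
  multiple of \<open>\<bar>s - r\<bar> powr (2 * e - 1)\<close>. Its \<open>k\<close>-th power is integrable on the square since
  \<open>(1 - 2 * e) * k < 1\<close>.
\<close>

section \<open>Tonelli identities for products and squares\<close>

text \<open>Lebesgue measure on \<open>real ^ 'k\<close> is a product over \<open>Basis\<close>,
  whose vectors are the \<open>axis i 1\<close>. Coordinates are therefore inner products with basis
  vectors, and the integral factors into equal one-dimensional ones.\<close>

lemma nn_integral_prod_components:
  fixes f :: "real \<Rightarrow> real"
  assumes [measurable]: "f \<in> borel_measurable borel" and nonneg: "\<And>x. f x \<ge> 0"
  shows "(\<integral>\<^sup>+y. ennreal (\<Prod>i\<in>UNIV. f (y $ i)) \<partial>(lborel :: (real ^ 'k::finite) measure))
    = (\<integral>\<^sup>+x. ennreal (f x) \<partial>lborel) ^ CARD('k)"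
proof -
  have inj: "inj (\<lambda>i::'k. axis i (1::real))"
    by (auto simp: inj_on_def axis_eq_axis)
  have Basis: "(Basis :: (real ^ 'k) set) = range (\<lambda>i. axis i 1)"
    by (auto simp: Basis_vec_def)
  have "(\<Prod>i\<in>UNIV. f (y $ i)) = (\<Prod>b\<in>Basis. f (y \<bullet> b))" for y :: "real ^ 'k"
    unfolding Basis by (subst prod.reindex[OF inj]) (simp add: inner_axis)
  then have "(\<integral>\<^sup>+y. ennreal (\<Prod>i\<in>UNIV. f (y $ i)) \<partial>(lborel :: (real ^ 'k) measure))
    = (\<integral>\<^sup>+y. (\<Prod>b\<in>Basis. ennreal (f (y \<bullet> b))) \<partial>(lborel :: (real ^ 'k) measure))"
    using nonneg by (simp add: prod_ennreal)
  also have "\<dots> = (\<Prod>b\<in>(Basis :: (real ^ 'k) set). (\<integral>\<^sup>+x. ennreal (f x) \<partial>lborel))"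
    using nonneg by (subst prod_ennreal, simp, subst prod_ennreal[symmetric], simp,
        intro nn_integral_lborel_prod[of "\<lambda>_. f"]) auto
  finally show ?thesis
    by simp
qed

text \<open>The square is a double integral in \<open>s\<close> and \<open>r\<close>; two exchanges
  of integrals then move \<open>y\<close> innermost.\<close>

lemma nn_integral_square:
  assumes "sigma_finite_measure M" "sigma_finite_measure N"
    and F [measurable]: "(\<lambda>(y, s). F y s) \<in> borel_measurable (M \<Otimes>\<^sub>M N)"
  shows "(\<integral>\<^sup>+y. (\<integral>\<^sup>+s. F y s \<partial>N)\<^sup>2 \<partial>M) = (\<integral>\<^sup>+s. \<integral>\<^sup>+r. \<integral>\<^sup>+y. F y s * F y r \<partial>M \<partial>N \<partial>N)"
proof -
  interpret M: sigma_finite_measure M by fact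
  interpret N: sigma_finite_measure N by fact
  interpret pair_sigma_finite M N ..
  have "(\<integral>\<^sup>+y. (\<integral>\<^sup>+s. F y s \<partial>N)\<^sup>2 \<partial>M) = (\<integral>\<^sup>+y. \<integral>\<^sup>+s. \<integral>\<^sup>+r. F y s * F y r \<partial>N \<partial>N \<partial>M)"
    unfolding power2_eq_square
    by (intro nn_integral_cong) (simp add: nn_integral_cmult nn_integral_multc)
  also have "\<dots> = (\<integral>\<^sup>+s. \<integral>\<^sup>+y. \<integral>\<^sup>+r. F y s * F y r \<partial>N \<partial>M \<partial>N)"
    by (rule Fubini'[symmetric]) measurable
  also have "\<dots> = (\<integral>\<^sup>+s. \<integral>\<^sup>+r. \<integral>\<^sup>+y. F y s * F y r \<partial>M \<partial>N \<partial>N)"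
    by (intro nn_integral_cong Fubini'[symmetric]) measurable
  finally show ?thesis .
qed

section \<open>One-dimensional kernels and their correlations\<close>

lemma pos_powr_nonneg: "pos_powr x p \<ge> 0"
  by (simp add: pos_powr_def)

lemma pos_powr_measurable [measurable]: "(\<lambda>x. pos_powr x p) \<in> borel_measurable borel"
  unfolding pos_powr_def by measurable

lemma pos_part_measurable [measurable]: "pos_part \<in> borel_measurable borel"
  unfolding pos_part_def by measurable

text \<open>With \<open>p = d - e\<close>, this bounds \<open>x powr p * exp (- lam * x)\<close> by
  a constant, through \<open>ln z \<le> z\<close> at \<open>z = lam * x / (p + 1)\<close>. Dividing
  by \<open>p + 1\<close> instead of \<open>p\<close> covers \<open>p = 0\<close> at the cost of a
  suboptimal constant.\<close>

lemma pos_powr_exp_le: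
  assumes "lam > 0" "e \<le> d"
  shows "pos_powr x (d - 1) * exp (- lam * pos_part x)
    \<le> exp ((d - e) * ln ((d - e + 1) / lam)) * pos_powr x (e - 1)"
proof (cases "x > 0")
  case True
  define p where "p = d - e"
  have p: "p \<ge> 0" using assms by (simp add: p_def)
  have "ln (lam * x / (p + 1)) \<le> lam * x / (p + 1)"
    using ln_le_minus_one[of "lam * x / (p + 1)"] True assms p by simp
  moreover have "ln (lam * x / (p + 1)) = ln x - ln ((p + 1) / lam)"
    using True assms p by (simp add: ln_div ln_mult)
  ultimately have "p * ln x \<le> p * (lam * x / (p + 1) + ln ((p + 1) / lam))"
    using p by (intro mult_left_mono) auto
  also have "\<dots> \<le> lam * x + p * ln ((p + 1) / lam)"
  proof -
    have "p * (lam * x) \<le> (p + 1) * (lam * x)"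
      using True assms p by (intro mult_right_mono) auto
    then have "p * (lam * x / (p + 1)) \<le> lam * x"
      using p by (simp add: field_simps)
    then show ?thesis
      by (simp add: distrib_left)
  qed
  finally have "p * ln x - lam * x \<le> p * ln ((p + 1) / lam)" by simp
  moreover have "x powr (d - 1) = exp (p * ln x) * x powr (e - 1)"
    using True by (simp add: powr_def p_def algebra_simps flip: exp_add)
  then have "x powr (d - 1) * exp (- lam * x) = exp (p * ln x - lam * x) * x powr (e - 1)"
    by (simp add: exp_diff exp_minus field_simps)
  ultimately show ?thesis
    using True by (simp add: pos_powr_def pos_part_def p_def)
qed (simp add: pos_powr_def)

lemma nn_integral_powr_from_0:
  assumes "a > - 1" "c \<ge> 0"
  shows "(\<integral>\<^sup>+x. ennreal (x powr a) * indicator {0..c} x \<partial>lborel) = ennreal (c powr (a + 1) / (a + 1))"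
  using assms by (intro nn_integral_has_integral_lebesgue' has_integral_powr_from_0) auto

text \<open>Split at \<open>x = u\<close>. Below, \<open>x + u\<close> is replaced by
  \<open>u\<close> and \<open>x powr (e - 1)\<close> is integrable at 0, giving
  \<open>1 / e\<close>. Above, it is replaced by \<open>x\<close>, and \<open>e < 1/2\<close> makes
  the tail integrable, giving \<open>1 / (1 - 2 * e)\<close>.\<close>

lemma nn_integral_pos_powr_shift_le:
  assumes "0 < e" "e < 1/2" "u > 0"
  shows "(\<integral>\<^sup>+x. ennreal (pos_powr (x + u) (e - 1) * pos_powr x (e - 1)) \<partial>lborel)
    \<le> ennreal ((1 / e + 1 / (1 - 2 * e)) * u powr (2 * e - 1))"
proof -
  have pow: "u powr (e - 1) * u powr e = u powr (2 * e - 1)"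
    by (simp flip: powr_add)
  have "(\<integral>\<^sup>+x. ennreal (pos_powr (x + u) (e - 1) * pos_powr x (e - 1)) \<partial>lborel)
    \<le> (\<integral>\<^sup>+x. ennreal (u powr (e - 1)) * (ennreal (x powr (e - 1)) * indicator {0..u} x)
          + ennreal (x powr (2 * e - 2)) * indicator {u..} x \<partial>lborel)"
  proof (intro nn_integral_mono)
    fix x :: real
    show "ennreal (pos_powr (x + u) (e - 1) * pos_powr x (e - 1))
      \<le> ennreal (u powr (e - 1)) * (ennreal (x powr (e - 1)) * indicator {0..u} x)
          + ennreal (x powr (2 * e - 2)) * indicator {u..} x"
    proof (cases "x > 0")
      case True
      consider "x \<le> u" | "x > u" by linarith
      then show ?thesis
      proof cases
        case 1
        have "(x + u) powr (e - 1) * x powr (e - 1) \<le> u powr (e - 1) * x powr (e - 1)"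
          using True assms by (intro mult_right_mono powr_mono2') auto
        then have "ennreal (pos_powr (x + u) (e - 1) * pos_powr x (e - 1))
          \<le> ennreal (u powr (e - 1)) * ennreal (x powr (e - 1))"
          using True assms by (simp add: pos_powr_def ennreal_leI flip: ennreal_mult)
        also have "\<dots> \<le> \<dots> + ennreal (x powr (2 * e - 2)) * indicator {u..} x"
          by simp
        finally show ?thesis
          using 1 True by simp
      next
        case 2
        have "(x + u) powr (e - 1) * x powr (e - 1) \<le> x powr (e - 1) * x powr (e - 1)"
          using True assms by (intro mult_right_mono powr_mono2') auto
        also have "\<dots> = x powr (2 * e - 2)"
          by (simp flip: powr_add)
        finally show ?thesis
          using 2 True assms by (simp add: pos_powr_def ennreal_leI)
      qed
    qed (simp add: pos_powr_def)
  qed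
  also have "\<dots> = ennreal (u powr (e - 1)) * ennreal (u powr e / e)
      + ennreal (- (u powr (2 * e - 2 + 1)) / (2 * e - 2 + 1))"
    using assms nn_integral_powr_from_0[of "e - 1" u]
      nn_integral_has_integral_lebesgue'[OF _ has_integral_powr_to_inf[of "2 * e - 2" u]]
    by (simp add: nn_integral_add nn_integral_cmult)
  also have "\<dots> = ennreal (u powr (e - 1) * (u powr e / e) + - (u powr (2 * e - 2 + 1)) / (2 * e - 2 + 1))"
    using assms by (subst ennreal_mult[symmetric], simp, simp, subst ennreal_plus)
      (auto simp: divide_nonneg_neg divide_le_0_iff)
  also have "u powr (e - 1) * (u powr e / e) + - (u powr (2 * e - 2 + 1)) / (2 * e - 2 + 1)
    = (1 / e + 1 / (1 - 2 * e)) * u powr (2 * e - 1)"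
    using assms pow by (simp add: field_simps)
  finally show ?thesis .
qed

text \<open>For \<open>r < s\<close>, substituting \<open>y = r - x\<close> gives the shift
  \<open>u = s - r\<close>; the other case is symmetric. On the diagonal the left side is infinite,
  while \<open>0 powr (2 * e - 1)\<close> is 0.\<close>

lemma nn_integral_pos_powr_correlation_le:
  assumes "0 < e" "e < 1/2" "s \<noteq> r"
  shows "(\<integral>\<^sup>+y. ennreal (pos_powr (s - y) (e - 1) * pos_powr (r - y) (e - 1)) \<partial>lborel)
    \<le> ennreal ((1 / e + 1 / (1 - 2 * e)) * \<bar>s - r\<bar> powr (2 * e - 1))"
proof -
  have *: "(\<integral>\<^sup>+y. ennreal (pos_powr (s - y) (e - 1) * pos_powr (r - y) (e - 1)) \<partial>lborel)
    \<le> ennreal ((1 / e + 1 / (1 - 2 * e)) * \<bar>s - r\<bar> powr (2 * e - 1))" if "r < s" for s r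
  proof -
    have "(\<integral>\<^sup>+y. ennreal (pos_powr (s - y) (e - 1) * pos_powr (r - y) (e - 1)) \<partial>lborel)
      = (\<integral>\<^sup>+x. ennreal (pos_powr (x + (s - r)) (e - 1) * pos_powr x (e - 1)) \<partial>lborel)"
      by (subst nn_integral_real_affine[where t = r and c = "-1"]) (auto simp: algebra_simps)
    then show ?thesis
      using nn_integral_pos_powr_shift_le[of e "s - r"] assms that by simp
  qed
  consider "r < s" | "s < r" using assms by linarith
  then show ?thesis
    by cases (use *[of r s] *[of s r] in \<open>simp_all add: mult.commute abs_minus_commute\<close>)
qed

lemma nn_integral_abs_diff_powr_le:
  assumes "a > - 1" "t \<ge> 0" "s \<in> {0..t}"
  shows "(\<integral>\<^sup>+r. ennreal (\<bar>s - r\<bar> powr a) * indicator {0..t} r \<partial>lborel)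
    \<le> 2 * ennreal (t powr (a + 1) / (a + 1))"
proof -
  let ?p = "\<lambda>x. ennreal (x powr a) * indicator {0..t} x"
  \<comment> \<open>One of \<open>s - r\<close> and \<open>r - s\<close> equals the absolute value
    and lies in \<open>{0..t}\<close>, whence the factor 2. Both are written in the affine form that
    the change of variables expects.\<close>
  have "(\<integral>\<^sup>+r. ennreal (\<bar>s - r\<bar> powr a) * indicator {0..t} r \<partial>lborel)
    \<le> (\<integral>\<^sup>+r. ?p (s + - 1 * r) + ?p (- s + 1 * r) \<partial>lborel)"
    using assms by (intro nn_integral_mono) (auto simp: indicator_def abs_real_def)
  also have "\<dots> = (\<integral>\<^sup>+r. ?p (s + - 1 * r) \<partial>lborel) + (\<integral>\<^sup>+r. ?p (- s + 1 * r) \<partial>lborel)"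
    by (intro nn_integral_add) measurable
  also have "(\<integral>\<^sup>+r. ?p (s + - 1 * r) \<partial>lborel) = (\<integral>\<^sup>+x. ?p x \<partial>lborel)"
    by (subst (2) nn_integral_real_affine[where t = s and c = "-1"]) auto
  also have "(\<integral>\<^sup>+r. ?p (- s + 1 * r) \<partial>lborel) = (\<integral>\<^sup>+x. ?p x \<partial>lborel)"
    by (subst (2) nn_integral_real_affine[where t = "- s" and c = 1]) auto
  also have "(\<integral>\<^sup>+x. ?p x \<partial>lborel) + (\<integral>\<^sup>+x. ?p x \<partial>lborel) = 2 * ennreal (t powr (a + 1) / (a + 1))"
    using assms by (simp add: nn_integral_powr_from_0 mult_2)
  finally show ?thesis .
qed

section \<open>Correlations of the integrand and the square integral\<close>

lemma hermite_integrand_nonneg: "hermite_integrand d lam y s \<ge> 0"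
  unfolding hermite_integrand_def by (intro prod_nonneg) (auto simp: pos_powr_nonneg)

lemma hermite_integrand_measurable:
  "(\<lambda>(y :: real ^ 'k::finite, s). hermite_integrand d lam y s) \<in> borel_measurable (lborel \<Otimes>\<^sub>M lborel)"
proof -
  have [measurable]: "(\<lambda>x :: (real ^ 'k) \<times> real. fst x $ i) \<in> borel_measurable (borel \<Otimes>\<^sub>M borel)" for i
    by (rule measurable_compose[OF measurable_fst borel_measurable_nth])
  show ?thesis
    unfolding hermite_integrand_def by measurable
qed

lemma nn_integral_hermite_integrand_correlation_le:
  assumes "lam > 0" "0 < e" "e < 1/2" "e \<le> d"
  obtains C where "C \<ge> 0"
    and "\<And>s r. s \<noteq> r \<Longrightarrow>
      (\<integral>\<^sup>+y. ennreal (hermite_integrand d lam y s) * ennreal (hermite_integrand d lam y r)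
        \<partial>(lborel :: (real ^ 'k::finite) measure))
      \<le> ennreal (C * \<bar>s - r\<bar> powr ((2 * e - 1) * real CARD('k)))"
proof
  define g where "g x = pos_powr x (d - 1) * exp (- lam * pos_part x)" for x
  define A where "A = exp ((d - e) * ln ((d - e + 1) / lam))"
  define B where "B = A\<^sup>2 * (1 / e + 1 / (1 - 2 * e))"
  have [measurable]: "g \<in> borel_measurable borel"
    unfolding g_def by measurable
  have g_nonneg: "g x \<ge> 0" and g_le: "g x \<le> A * pos_powr x (e - 1)" for x
    using pos_powr_exp_le[OF assms(1,4)] by (auto simp: g_def A_def pos_powr_nonneg)
  have B: "B \<ge> 0"
    using assms by (simp add: B_def)
  \<comment> \<open>This fixes the witness for \<open>C\<close>: each coordinate contributes one
    factor \<open>B\<close>.\<close>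
  then show "B ^ CARD('k) \<ge> 0" by simp
  fix s r :: real assume "s \<noteq> r"
  have "(\<integral>\<^sup>+y. ennreal (hermite_integrand d lam y s) * ennreal (hermite_integrand d lam y r)
        \<partial>(lborel :: (real ^ 'k) measure))
    = (\<integral>\<^sup>+y. ennreal (\<Prod>i\<in>UNIV. g (s - y $ i) * g (r - y $ i)) \<partial>(lborel :: (real ^ 'k) measure))"
    by (simp add: hermite_integrand_nonneg flip: ennreal_mult)
      (simp add: hermite_integrand_def g_def prod.distrib)
  also have "\<dots> = (\<integral>\<^sup>+x. ennreal (g (s - x) * g (r - x)) \<partial>lborel) ^ CARD('k)"
    by (rule nn_integral_prod_components) (auto simp: g_nonneg)
  also have "\<dots> \<le> ennreal (B * \<bar>s - r\<bar> powr (2 * e - 1)) ^ CARD('k)"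
  proof (intro power_mono)
    have "(\<integral>\<^sup>+x. ennreal (g (s - x) * g (r - x)) \<partial>lborel)
      \<le> (\<integral>\<^sup>+x. ennreal (A\<^sup>2) * ennreal (pos_powr (s - x) (e - 1) * pos_powr (r - x) (e - 1)) \<partial>lborel)"
    proof (intro nn_integral_mono)
      fix x
      have "g (s - x) * g (r - x) \<le> (A * pos_powr (s - x) (e - 1)) * (A * pos_powr (r - x) (e - 1))"
        by (intro mult_mono g_le g_nonneg mult_nonneg_nonneg) (auto simp: A_def pos_powr_nonneg)
      also have "\<dots> = A\<^sup>2 * (pos_powr (s - x) (e - 1) * pos_powr (r - x) (e - 1))"
        by (simp add: power2_eq_square)
      finally show "ennreal (g (s - x) * g (r - x))
        \<le> ennreal (A\<^sup>2) * ennreal (pos_powr (s - x) (e - 1) * pos_powr (r - x) (e - 1))"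
        by (simp add: ennreal_leI pos_powr_nonneg flip: ennreal_mult)
    qed
    also have "\<dots> = ennreal (A\<^sup>2)
        * (\<integral>\<^sup>+x. ennreal (pos_powr (s - x) (e - 1) * pos_powr (r - x) (e - 1)) \<partial>lborel)"
      by (intro nn_integral_cmult) measurable
    also have "\<dots> \<le> ennreal (A\<^sup>2) * ennreal ((1 / e + 1 / (1 - 2 * e)) * \<bar>s - r\<bar> powr (2 * e - 1))"
      using assms \<open>s \<noteq> r\<close> by (intro mult_left_mono nn_integral_pos_powr_correlation_le) auto
    also have "\<dots> = ennreal (B * \<bar>s - r\<bar> powr (2 * e - 1))"
      using assms by (simp add: B_def mult.assoc flip: ennreal_mult)
    finally show "(\<integral>\<^sup>+x. ennreal (g (s - x) * g (r - x)) \<partial>lborel)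
      \<le> ennreal (B * \<bar>s - r\<bar> powr (2 * e - 1))" .
  qed simp
  also have "\<dots> = ennreal (B ^ CARD('k) * \<bar>s - r\<bar> powr ((2 * e - 1) * real CARD('k)))"
    using B \<open>s \<noteq> r\<close> by (simp add: ennreal_power power_mult_distrib powr_powr flip: powr_realpow)
  finally show "(\<integral>\<^sup>+y. ennreal (hermite_integrand d lam y s) * ennreal (hermite_integrand d lam y r)
        \<partial>(lborel :: (real ^ 'k) measure))
    \<le> ennreal (B ^ CARD('k) * \<bar>s - r\<bar> powr ((2 * e - 1) * real CARD('k)))" .
qed

text \<open>The fifth hypothesis says that the exponent \<open>a\<close> of
  \<open>\<bar>s - r\<bar>\<close> exceeds -1, so the diagonal singularity is integrable on the
  square.\<close>

lemma nn_integral_hermite_square_finite: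
  assumes "lam > 0" "0 < e" "e < 1/2" "e \<le> d" "(1 - 2 * e) * real CARD('k) < 1" "t \<ge> 0"
  shows "(\<integral>\<^sup>+y. (\<integral>\<^sup>+s. ennreal (hermite_integrand d lam y s) * indicator {0..t} s \<partial>lborel)\<^sup>2
      \<partial>(lborel :: (real ^ 'k::finite) measure)) < \<infinity>"
proof -
  note [measurable] = hermite_integrand_measurable
  define a where "a = (2 * e - 1) * real CARD('k)"
  have a: "a > - 1"
    using assms by (simp add: a_def algebra_simps)
  obtain C where C: "C \<ge> 0" and le: "\<And>s r. s \<noteq> r \<Longrightarrow>
      (\<integral>\<^sup>+y. ennreal (hermite_integrand d lam y s) * ennreal (hermite_integrand d lam y r)
        \<partial>(lborel :: (real ^ 'k) measure)) \<le> ennreal (C * \<bar>s - r\<bar> powr a)"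
    by (rule nn_integral_hermite_integrand_correlation_le[OF assms(1-4), where 'k = 'k, folded a_def]) (rule that)
  let ?F = "\<lambda>(y :: real ^ 'k) s. ennreal (hermite_integrand d lam y s) * indicator {0..t} s"
  have "(\<integral>\<^sup>+y. (\<integral>\<^sup>+s. ?F y s \<partial>lborel)\<^sup>2 \<partial>lborel)
    = (\<integral>\<^sup>+s. \<integral>\<^sup>+r. \<integral>\<^sup>+y. ?F y s * ?F y r \<partial>lborel \<partial>lborel \<partial>lborel)"
    by (rule nn_integral_square) (auto intro: sigma_finite_lborel)
  also have "\<dots> \<le> (\<integral>\<^sup>+s. \<integral>\<^sup>+r. (ennreal C * indicator {0..t} s)
      * (ennreal (\<bar>s - r\<bar> powr a) * indicator {0..t} r) \<partial>lborel \<partial>lborel)"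
  \<comment> \<open>For fixed \<open>s\<close>, the correlation bound fails to apply only at the
    null set \<open>r = s\<close>.\<close>
  proof (rule nn_integral_mono, rule nn_integral_mono_AE)
    fix s :: real
    have "(\<integral>\<^sup>+y. ?F y s * ?F y r \<partial>lborel) \<le> (ennreal C * indicator {0..t} s)
      * (ennreal (\<bar>s - r\<bar> powr a) * indicator {0..t} r)" if "r \<noteq> s" for r
      using le[of s r] C that by (auto simp: indicator_def ennreal_mult)
    then show "AE r in lborel. (\<integral>\<^sup>+y. ?F y s * ?F y r \<partial>lborel) \<le> (ennreal C * indicator {0..t} s)
      * (ennreal (\<bar>s - r\<bar> powr a) * indicator {0..t} r)"
      using AE_lborel_singleton[of s] by (auto elim!: eventually_mono)
  qed
  also have "\<dots> = (\<integral>\<^sup>+s. (ennreal C * indicator {0..t} s)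
      * (\<integral>\<^sup>+r. ennreal (\<bar>s - r\<bar> powr a) * indicator {0..t} r \<partial>lborel) \<partial>lborel)"
    by (intro nn_integral_cong nn_integral_cmult) measurable
  also have "\<dots> \<le> (\<integral>\<^sup>+s. ennreal C * (2 * ennreal (t powr (a + 1) / (a + 1))) * indicator {0..t} s \<partial>lborel)"
  proof (intro nn_integral_mono)
    fix s :: real
    show "(ennreal C * indicator {0..t} s) * (\<integral>\<^sup>+r. ennreal (\<bar>s - r\<bar> powr a) * indicator {0..t} r \<partial>lborel)
      \<le> ennreal C * (2 * ennreal (t powr (a + 1) / (a + 1))) * indicator {0..t} s"
    proof (cases "s \<in> {0..t}")
      case True
      then show ?thesis
        using nn_integral_abs_diff_powr_le[OF a assms(6) True] by (simp add: mult_left_mono)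
    qed auto
  qed
  also have "\<dots> = ennreal C * (2 * ennreal (t powr (a + 1) / (a + 1))) * ennreal t"
    using assms by (simp add: nn_integral_cmult_indicator)
  also have "\<dots> < \<infinity>"
    by (simp add: ennreal_mult_less_top)
  finally show ?thesis .
qed

section \<open>Almost everywhere integrability and membership in \<open>L2\<close>\<close>

theorem lemma1:
  fixes H lam d t :: real
  assumes "H > 1/2"
    and "lam > 0"
    and "d = 1/2 - (1 - H) / real CARD('k::finite)"
    and "t \<ge> 0"
  shows "(AE y :: real ^ 'k in lborel. set_integrable lborel {0..t} (hermite_integrand d lam y))
       \<and> (hermite_kernel d lam t :: real ^ 'k \<Rightarrow> real) \<in> L2 lborel"
proof -
  note [measurable] = hermite_integrand_measurable
  define k where "k = real CARD('k)"
  have k: "k \<ge> 1"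
    unfolding k_def using zero_less_card_finite[where 'a = 'k] by linarith
  have d: "d = 1/2 - (1 - H) / k"
    using assms by (simp add: k_def)
  \<comment> \<open>A smaller exponent only weakens the majorant \<open>x powr (e - 1)\<close>; the cap below \<open>1/2\<close> makes
    the tails of the correlations integrable, also when \<open>d \<ge> 1/2\<close>.\<close>
  define e where "e = min d (1/2 - 1 / (4 * k))"
  have "(1 - H) / k < (1/2) / k" "(1/2) / k \<le> 1/2" "1 / (4 * k) \<le> 1/4"
    using k assms(1) by (auto simp: field_simps)
  then have "0 < d" "0 < 1/2 - 1 / (4 * k)"
    unfolding d by linarith+
  moreover have "1 / (4 * k) > 0"
    using k by simp
  ultimately have e0: "0 < e" and e: "e < 1/2" "e \<le> d"
    unfolding e_def by linarith+
  \<comment> \<open>For \<open>e = d\<close> the left side is \<open>2 * (1 - H)\<close>, so this is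
    where \<open>H > 1/2\<close> enters; for the cap it is \<open>1/2\<close>.\<close>
  have ek: "(1 - 2 * e) * k < 1"
  proof -
    have "(1 - 2 * d) * k < 1" "(1 - 2 * (1/2 - 1 / (4 * k))) * k < 1"
      using k assms(1) by (auto simp: d field_simps)
    then show ?thesis
      by (auto simp: e_def min_def)
  qed
  \<comment> \<open>The extended-valued kernel: since the integrand is nonnegative, finiteness of
    \<open>G y\<close> amounts to integrability.\<close>
  define G where "G y = (\<integral>\<^sup>+s. ennreal (hermite_integrand d lam y s) * indicator {0..t} s \<partial>lborel)"
    for y :: "real ^ 'k"
  have [measurable]: "G \<in> borel_measurable lborel"
    unfolding G_def by measurable
  have fin: "(\<integral>\<^sup>+y. (G y)\<^sup>2 \<partial>lborel) < \<infinity>"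
    unfolding G_def using nn_integral_hermite_square_finite[where 'k = 'k] assms e0 e ek
    by (auto simp: k_def)
  have G_eq: "G y = (\<integral>\<^sup>+s. ennreal (indicat_real {0..t} s * hermite_integrand d lam y s) \<partial>lborel)" for y
    unfolding G_def by (intro nn_integral_cong) (simp add: indicator_def)
  have slice [measurable]: "hermite_integrand d lam y \<in> borel_measurable lborel" for y :: "real ^ 'k"
    using measurable_compose[OF measurable_Pair1' hermite_integrand_measurable] by simp
  have "AE y in lborel. (G y)\<^sup>2 \<noteq> \<infinity>"
    using fin by (intro nn_integral_noteq_infinite) auto
  then have "AE y in lborel. G y < \<infinity>"
    by eventually_elim (auto simp: power_less_top_ennreal simp flip: less_top)
  then have "AE y :: real ^ 'k in lborel. set_integrable lborel {0..t} (hermite_integrand d lam y)"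
  proof eventually_elim
    case (elim y)
    then show ?case
      unfolding set_integrable_def G_eq
      by (intro integrableI_nonneg) (auto simp: hermite_integrand_nonneg)
  qed
  \<comment> \<open>This holds at every \<open>y\<close>: where \<open>G y\<close> is infinite, both
    sides are 0 by convention.\<close>
  moreover have kernel: "hermite_kernel d lam t y = enn2real (G y)" for y :: "real ^ 'k"
    unfolding hermite_kernel_def set_lebesgue_integral_def G_eq
    by (subst integral_eq_nn_integral) (auto simp: hermite_integrand_nonneg)
  moreover have "integrable lborel (\<lambda>y :: real ^ 'k. (hermite_kernel d lam t y)\<^sup>2)"
  proof (intro integrableI_nonneg)
    have "(\<integral>\<^sup>+y. ennreal ((enn2real (G y))\<^sup>2) \<partial>lborel) \<le> (\<integral>\<^sup>+y. (G y)\<^sup>2 \<partial>lborel)"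
    proof (intro nn_integral_mono)
      fix y
      show "ennreal ((enn2real (G y))\<^sup>2) \<le> (G y)\<^sup>2"
        by (cases "G y") (simp_all add: ennreal_power)
    qed
    with fin show "(\<integral>\<^sup>+y. ennreal ((hermite_kernel d lam t (y :: real ^ 'k))\<^sup>2) \<partial>lborel) < \<infinity>"
      unfolding kernel by order
  qed (auto simp: kernel)
  moreover have "(hermite_kernel d lam t :: real ^ 'k \<Rightarrow> real) \<in> borel_measurable lborel"
    unfolding kernel[abs_def] by measurable
  ultimately show ?thesis
    by (simp add: L2_def)
qed

end
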